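(* For every integer $n\ge1$, $$C(n,-\infty)=\frac{1}{2^n}\binom{2n}{n}.$$
   Context: A function $f:\mathbf{R}^n\to[0,\infty]$ is $(-\infty)$-concave (quasi-concave) if $f(tx+(1-t)y)\ge\min\{f(x),f(y)\}$ for all $x,y\in\mathbf{R}^n$ and all $t\in[0,1]$. The difference function of order $-\infty$ of $f:\mathbf{R}^n\to[0,\infty]$ is $$\Delta_{-\infty}f(z)=\sup\left\{\min\{f(x),f(-y)\}\;:\;x,y\in\mathbf{R}^n,\ \tfrac12(x+y)=z\right\},\quad z\in\mathbf{R}^n.$$ The constant is $$C(n,-\infty)=\sup\left\{\frac{\int_{\mathbf{R}^n}\Delta_{-\infty}f\,dz}{\int_{\mathbf{R}^n}f\,dx}\;:\;f:\mathbf{R}^n\to[0,\infty]\ \text{is } (-\infty)\text{-concave},\ 0<\int_{\mathbf{R}^n}f\,dx<\infty\right\}.$$ *)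

theory Defs
  imports "HOL-Analysis.Analysis"
begin

definition quasi_concave :: "(real ^ 'n \<Rightarrow> ennreal) \<Rightarrow> bool" where
  "quasi_concave f \<longleftrightarrow>
     (\<forall>x y. \<forall>t\<in>{0..1}. f (t *\<^sub>R x + (1 - t) *\<^sub>R y) \<ge> min (f x) (f y))"

definition diff_fun :: "(real ^ 'n \<Rightarrow> ennreal) \<Rightarrow> real ^ 'n \<Rightarrow> ennreal" where
  "diff_fun f z = Sup {min (f x) (f (- y)) | x y. (1 / 2) *\<^sub>R (x + y) = z}"

text \<open>Integrals are taken over \<open>lebesgue\<close>, not \<open>lborel\<close>: the superlevel sets of a
  quasi-concave function, and of its difference function, are convex, hence Lebesgue
  measurable but not necessarily Borel. So no measurability assumption on \<open>f\<close> is needed.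
  The dimension is the cardinality of the index type.\<close>

definition diff_const :: "'n::finite itself \<Rightarrow> ennreal" where
  "diff_const _ =
     Sup {(\<integral>\<^sup>+ z. diff_fun f z \<partial>lebesgue) / (\<integral>\<^sup>+ x. f x \<partial>lebesgue) | f :: real ^ 'n \<Rightarrow> ennreal.
          quasi_concave f \<and> 0 < (\<integral>\<^sup>+ x. f x \<partial>lebesgue) \<and> (\<integral>\<^sup>+ x. f x \<partial>lebesgue) < \<infinity>}"

end

theory Submission
  imports Defs
begin

text \<open>The superlevel sets of \<open>diff_fun f\<close> are \<open>(K - K) / 2\<close> for the superlevel sets
  \<open>K\<close> of \<open>f\<close>, so by the layer cake formula everything reduces to the Rogers--Shephard
  inequality \<open>vol (K - K) \<le> (2n choose n) vol K\<close> for convex \<open>K\<close> and its equality case.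
  Let \<open>V = vol K\<close>. The covariogram \<open>g x = vol (K \<inter> (K - x))\<close> integrates to \<open>V\<^sup>2\<close>. If
  \<open>x \<in> (1 - w)(K - K)\<close>, then \<open>K \<inter> (K - x)\<close> contains a translate of \<open>w K\<close> by convexity, so
  \<open>g x \<ge> w^n V\<close>; no Brunn--Minkowski inequality is needed. Thus \<open>g \<ge> V (1 - \<rho>)^n\<close> with the
  gauge \<open>\<rho>\<close> of \<open>K - K\<close>, and the right-hand side integrates to \<open>V vol (K - K) / (2n choose n)\<close>
  by a Beta integral. For a simplex the sets \<open>K \<inter> (K - x)\<close> are themselves translates of
  \<open>(1 - \<rho>) K\<close>, which gives equality.\<close>

section \<open>Difference bodies and affine images\<close>

definition difference_body :: "'a::ab_group_add set \<Rightarrow> 'a set" where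
  "difference_body K = {x - y | x y. x \<in> K \<and> y \<in> K}"

lemma difference_body_iff: "x \<in> difference_body K \<longleftrightarrow> (\<exists>y\<in>K. y + x \<in> K)"
proof
  assume "\<exists>y\<in>K. y + x \<in> K"
  then obtain y where "y \<in> K" "y + x \<in> K" by blast
  moreover have "x = (y + x) - y" by simp
  ultimately show "x \<in> difference_body K"
    unfolding difference_body_def by blast
next
  assume "x \<in> difference_body K"
  then obtain u v where "x = u - v" "u \<in> K" "v \<in> K"
    unfolding difference_body_def by blast
  then show "\<exists>y\<in>K. y + x \<in> K"
    by (intro bexI[of _ v]) simp_all
qed

lemma open_difference_body:
  fixes K :: "'a::euclidean_space set"
  assumes "open K" shows "open (difference_body K)"
  unfolding difference_body_def
  using open_sums[OF disjI1[OF assms], of "uminus ` K"]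
  by (rule back_subst) force

lemma convex_difference_body:
  fixes K :: "'a::real_vector set"
  assumes "convex K" shows "convex (difference_body K)"
  using convex_differences[OF assms assms]
  by (rule back_subst) (auto simp: difference_body_def)

lemma emeasure_lborel_affine_image:
  fixes S :: "'a::euclidean_space set"
  assumes "S \<in> sets borel" "m \<noteq> 0"
  shows "emeasure lborel ((\<lambda>x. c + m *\<^sub>R x) ` S) = ennreal (\<bar>m\<bar> ^ DIM('a)) * emeasure lborel S"
proof -
  have "(\<lambda>x. c + m *\<^sub>R x) ` S = (\<lambda>y. (1 / m) *\<^sub>R (y - c)) -` S \<inter> space borel"
    using \<open>m \<noteq> 0\<close> by (force simp: image_iff)
  also have "\<dots> \<in> sets borel" using assms(1) by measurable
  finally have "(\<lambda>x. c + m *\<^sub>R x) ` S \<in> sets lborel" by simp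
  then show ?thesis
    using emeasure_lebesgue_affine[of m c S] assms(1)
    by (simp add: add.commute)
qed

section \<open>The Beta integral and the dilation weight\<close>

text \<open>The factor \<open>n\<close> turns B(n, n + 1) = (n - 1)! n! / (2n)! into the reciprocal
  of the central binomial coefficient.\<close>

lemma beta_integral_Ioo:
  fixes n :: nat
  assumes "n \<ge> 1"
  shows "(\<integral>\<^sup>+w. ennreal (real n * w ^ (n - 1) * (1 - w) ^ n) * indicator {0<..<1} w \<partial>lborel)
     = ennreal (1 / real ((2 * n) choose n))"
proof -
  have "((\<lambda>t. t powr (real n - 1) * (1 - t) powr (real (n + 1) - 1)) has_integral Beta (real n) (real (n + 1))) {0<..<1}"
    using has_integral_Beta_real[of "real n" "real (n + 1)"] assms
    by (simp add: has_integral_Icc_iff_Ioo)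
  then have "((\<lambda>t. real n * (t powr (real n - 1) * (1 - t) powr (real (n + 1) - 1)))
      has_integral real n * Beta (real n) (real (n + 1))) {0<..<1}"
    by (rule has_integral_mult_right)
  then have *: "((\<lambda>t. real n * t ^ (n - 1) * (1 - t) ^ n)
      has_integral real n * Beta (real n) (real (n + 1))) {0<..<1}"
    using assms by (elim has_integral_eq[rotated]) (auto simp flip: powr_realpow simp: of_nat_diff)
  obtain m where m: "n = Suc m" using assms by (cases n) auto
  have "Gamma (real n) = fact m" "Gamma (real (n + 1)) = fact n" "Gamma (real n + real (n + 1)) = fact (2 * n)"
    using Gamma_fact[of m, where 'a=real] Gamma_fact[of n, where 'a=real] Gamma_fact[of "2*n", where 'a=real] m
    by (simp_all add: algebra_simps)
  then have "real n * Beta (real n) (real (n + 1)) = fact n * fact n / fact (2 * n)"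
    unfolding Beta_def by (simp add: m)
  also have "\<dots> = 1 / real ((2 * n) choose n)"
    by (simp add: binomial_fact)
  finally show ?thesis
    using nn_integral_has_integral_lebesgue'[OF _ *] by simp
qed

text \<open>For an open convex \<open>D\<close> containing the origin, with Minkowski functional \<open>\<rho>\<close>, this
  equals \<open>(1 - \<rho>(x))^n\<close> on \<open>D\<close> and \<open>0\<close> outside.\<close>

definition dilation_weight :: "'a::euclidean_space set \<Rightarrow> 'a \<Rightarrow> ennreal" where
  "dilation_weight D x =
    (\<integral>\<^sup>+w. ennreal (DIM('a) * w ^ (DIM('a) - 1)) * indicator {0<..<1} w
       * indicator D ((1 / (1 - w)) *\<^sub>R x) \<partial>lborel)"

text \<open>After exchanging the integrals, the points \<open>x\<close> that count for a fixed
  \<open>w\<close> form (1 - w) D, of volume (1 - w)^n vol D. The remaining integral over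
  \<open>w\<close> is the Beta integral above.\<close>

lemma nn_integral_dilation_weight:
  fixes D :: "'a::euclidean_space set"
  assumes D: "open D"
  shows "(\<integral>\<^sup>+x. dilation_weight D x \<partial>lborel)
       = ennreal (1 / real ((2 * DIM('a)) choose DIM('a))) * emeasure lborel D"
proof -
  let ?n = "DIM('a)"
  have [measurable]: "D \<in> sets borel" using D by simp
  have "(\<integral>\<^sup>+x. \<integral>\<^sup>+w. ennreal (?n * w ^ (?n - 1)) * indicator {0<..<1} w
            * indicator D ((1 / (1 - w)) *\<^sub>R x) \<partial>lborel \<partial>lborel)
     = (\<integral>\<^sup>+w. \<integral>\<^sup>+x. ennreal (?n * w ^ (?n - 1)) * indicator {0<..<1} w
            * indicator D ((1 / (1 - w)) *\<^sub>R x) \<partial>(lborel::'a measure) \<partial>lborel)"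
    by (rule lborel_pair.Fubini') measurable
  also have "\<dots> = (\<integral>\<^sup>+w. ennreal (?n * w ^ (?n - 1) * (1 - w) ^ ?n) * indicator {0<..<1} w
       * emeasure lborel D \<partial>lborel)"
  proof (rule nn_integral_cong)
    fix w :: real
    show "(\<integral>\<^sup>+x. ennreal (?n * w ^ (?n - 1)) * indicator {0<..<1} w
            * indicator D ((1 / (1 - w)) *\<^sub>R x) \<partial>(lborel::'a measure))
      = ennreal (?n * w ^ (?n - 1) * (1 - w) ^ ?n) * indicator {0<..<1} w * emeasure lborel D"
    proof (cases "0 < w \<and> w < 1")
      case True
      have *: "indicator D ((1 / (1 - w)) *\<^sub>R x) = (indicator ((\<lambda>x. 0 + (1 - w) *\<^sub>R x) ` D) x :: ennreal)" for x
      proof -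
        have "x = (1 - w) *\<^sub>R y \<longleftrightarrow> y = (1 / (1 - w)) *\<^sub>R x" for y
          using True by auto
        then show ?thesis by (simp add: indicator_def image_iff)
      qed
      have "(\<integral>\<^sup>+x. indicator D ((1 / (1 - w)) *\<^sub>R x) \<partial>lborel) 
          = emeasure lborel ((\<lambda>x. 0 + (1 - w) *\<^sub>R x) ` D)"
        unfolding *
        by (rule nn_integral_indicator)
          (use True D open_scaling[of "1 - w" D] in auto)
      also have "\<dots> = ennreal ((1 - w) ^ ?n) * emeasure lborel D"
        using True by (subst emeasure_lborel_affine_image) auto
      finally show ?thesis using True
        by (simp add: nn_integral_cmult ennreal_mult' mult.assoc)
    qed (auto simp: indicator_def)
  qed
  also have "\<dots> = ennreal (1 / real ((2 * ?n) choose ?n)) * emeasure lborel D"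
    by (subst nn_integral_multc) (simp_all add: beta_integral_Ioo[OF DIM_positive[THEN Suc_leI, folded One_nat_def]] del: One_nat_def)
  finally show ?thesis
    unfolding dilation_weight_def .
qed

section \<open>The covariogram and the Rogers--Shephard inequality for open sets\<close>

text \<open>Fubini: for each fixed \<open>y\<close> in \<open>K\<close>, the admissible shifts
  \<open>x\<close> form the translate K - y, of volume vol K.\<close>

lemma nn_integral_covariogram:
  fixes K :: "'a::euclidean_space set"
  assumes K: "open K"
  shows "(\<integral>\<^sup>+x. emeasure lborel {y\<in>K. y + x \<in> K} \<partial>lborel) = emeasure lborel K * emeasure lborel K"
proof -
  have [measurable]: "K \<in> sets borel" using K by simp
  have "(\<integral>\<^sup>+x. emeasure lborel {y\<in>K. y + x \<in> K} \<partial>lborel)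
     = (\<integral>\<^sup>+x. \<integral>\<^sup>+y. indicator K y * indicator K (y + x) \<partial>lborel \<partial>lborel)"
  proof (rule nn_integral_cong)
    fix x :: 'a
    have "{y\<in>K. y + x \<in> K} \<in> sets lborel" by measurable
    then have "emeasure lborel {y\<in>K. y + x \<in> K} = (\<integral>\<^sup>+y. indicator {y\<in>K. y + x \<in> K} y \<partial>lborel)"
      by (rule nn_integral_indicator[symmetric])
    then show "emeasure lborel {y\<in>K. y + x \<in> K} = (\<integral>\<^sup>+y. indicator K y * indicator K (y + x) \<partial>lborel)"
      by (simp add: indicator_def if_distrib cong: if_cong) (auto intro!: nn_integral_cong)
  qed
  also have "\<dots> = (\<integral>\<^sup>+y. \<integral>\<^sup>+x. indicator K y * indicator K (y + x) \<partial>lborel \<partial>lborel)"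
    by (rule lborel_pair.Fubini') measurable
  also have "\<dots> = (\<integral>\<^sup>+y. indicator K y * emeasure lborel K \<partial>lborel)"
  proof (rule nn_integral_cong)
    fix y :: 'a
    have "(\<integral>\<^sup>+x. indicator K (y + x) \<partial>lborel) = (\<integral>\<^sup>+x. indicator K x \<partial>distr lborel borel ((+) y))"
      by (subst nn_integral_distr) auto
    also have "\<dots> = emeasure lborel K"
      by (simp add: lborel_distr_plus)
    finally show "(\<integral>\<^sup>+x. indicator K y * indicator K (y + x) \<partial>lborel) = indicator K y * emeasure lborel K"
      by (simp add: nn_integral_cmult)
  qed
  also have "\<dots> = emeasure lborel K * emeasure lborel K"
    by (simp add: nn_integral_multc)
  finally show ?thesis .
qed

lemma nn_integral_power_density:
  fixes n :: nat
  assumes "n \<ge> 1" "a \<ge> 0"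
  shows "(\<integral>\<^sup>+w. ennreal (real n * w ^ (n - 1)) * indicator {0..a} w \<partial>lborel) = ennreal (a ^ n)"
proof -
  have "(\<integral>\<^sup>+w. ennreal (real n * w ^ (n - 1)) * indicator {0..a} w \<partial>lborel) = ennreal (a ^ n - 0 ^ n)"
  proof (rule nn_integral_FTC_Icc)
    show "DERIV (\<lambda>w. w ^ n) w :> real n * w ^ (n - 1)" for w :: real
      using DERIV_power[OF DERIV_ident, where x=w and s=UNIV and n=n] by simp
  qed (use \<open>a \<ge> 0\<close> in auto)
  moreover have "(0::real) ^ n = 0" using \<open>n \<ge> 1\<close> by (intro zero_power) simp
  ultimately show ?thesis by simp
qed

text \<open>Turns a bound for every single dilation factor \<open>w\<close> into a bound for the
  weight: the hypothesis confines the contributing \<open>w\<close> to an interval from 0 to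
  \<open>a\<close>, on which the density n w^(n-1) has mass a^n.\<close>

lemma dilation_weight_mult_le:
  fixes D :: "'a::euclidean_space set"
  assumes V: "0 < V" "V < \<infinity>" and G: "G < \<infinity>"
    and le: "\<And>w. \<lbrakk>0 < w; w < 1; (1 / (1 - w)) *\<^sub>R x \<in> D\<rbrakk> \<Longrightarrow> ennreal (w ^ DIM('a)) * V \<le> G"
  shows "dilation_weight D x * V \<le> G"
proof -
  let ?n = "DIM('a)"
  obtain v where v: "V = ennreal v" "v > 0"
    using V by (cases V) auto
  obtain g where g: "G = ennreal g" "g \<ge> 0"
    using G by (cases G) auto
  \<comment> \<open>The threshold is chosen so that, for positive \<open>w\<close>, w^n V \<le> G
    holds exactly when w \<le> a.\<close>
  define a where "a = root ?n (g / v)"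
  have a: "a \<ge> 0" "a ^ ?n = g / v"
    using v g by (auto simp: a_def)
  have "w \<le> a" if "0 < w" "w < 1" "(1 / (1 - w)) *\<^sub>R x \<in> D" for w
  proof -
    have "ennreal (w ^ ?n * v) \<le> ennreal g"
      using le[OF that] v g that by (simp add: ennreal_mult)
    then have "w ^ ?n * v \<le> g" using g(2) by (simp add: ennreal_le_iff)
    then have "w ^ ?n \<le> a ^ ?n" using v by (simp add: a field_simps)
    then show ?thesis using a(1) that(1) by (simp add: power_mono_iff)
  qed
  then have "(\<integral>\<^sup>+w. ennreal (?n * w ^ (?n - 1)) * indicator {0<..<1} w
            * indicator D ((1 / (1 - w)) *\<^sub>R x) \<partial>lborel)
     \<le> (\<integral>\<^sup>+w. ennreal (?n * w ^ (?n - 1)) * indicator {0..a} w \<partial>lborel)"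
    by (intro nn_integral_mono) (auto simp: indicator_def)
  also have "\<dots> = ennreal (g / v)"
    using a by (simp add: nn_integral_power_density[OF DIM_positive[THEN Suc_leI, folded One_nat_def]] del: One_nat_def)
  finally have "(\<integral>\<^sup>+w. ennreal (?n * w ^ (?n - 1)) * indicator {0<..<1} w
            * indicator D ((1 / (1 - w)) *\<^sub>R x) \<partial>lborel) * V \<le> ennreal (g / v) * V"
    by (rule mult_right_mono) simp
  also have "\<dots> = G"
    using v g by (simp flip: ennreal_mult)
  finally show ?thesis
    unfolding dilation_weight_def .
qed

text \<open>The counterpart for the simplex: if all \<open>w\<close> in (0, a) contribute, the
  weight is at least the mass a^n of the density there.\<close>

lemma dilation_weight_ge:
  fixes D :: "'a::euclidean_space set"
  assumes a: "0 \<le> a" "a \<le> 1"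
    and mem: "\<And>w. \<lbrakk>0 < w; w < a\<rbrakk> \<Longrightarrow> (1 / (1 - w)) *\<^sub>R x \<in> D"
  shows "ennreal (a ^ DIM('a)) \<le> dilation_weight D x"
proof -
  have "ennreal (a ^ DIM('a)) = (\<integral>\<^sup>+w. ennreal (DIM('a) * w ^ (DIM('a) - 1)) * indicator {0..a} w \<partial>lborel)"
    using a by (simp add: nn_integral_power_density[OF DIM_positive[THEN Suc_leI, folded One_nat_def]] del: One_nat_def)
  also have "\<dots> \<le> (\<integral>\<^sup>+w. ennreal (DIM('a) * w ^ (DIM('a) - 1)) * indicator {0<..<1} w
            * indicator D ((1 / (1 - w)) *\<^sub>R x) \<partial>lborel)"
  proof (rule nn_integral_mono_AE)
    \<comment> \<open>Membership in \<open>D\<close> is known only strictly between 0 and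
      \<open>a\<close>; the two endpoints form a null set.\<close>
    have "AE w in lborel. w \<noteq> 0 \<and> w \<noteq> a"
      by (intro AE_conjI AE_lborel_singleton)
    then show "AE w in lborel. ennreal (DIM('a) * w ^ (DIM('a) - 1)) * indicator {0..a} w
      \<le> ennreal (DIM('a) * w ^ (DIM('a) - 1)) * indicator {0<..<1} w
            * indicator D ((1 / (1 - w)) *\<^sub>R x)"
      by eventually_elim (use a mem in \<open>auto simp: indicator_def\<close>)
  qed
  finally show ?thesis
    unfolding dilation_weight_def .
qed

text \<open>If \<open>q\<close> and q + x/(1 - w) lie in \<open>K\<close>, then mixing both with any
  \<open>k\<close> in \<open>K\<close> at weight \<open>w\<close> gives (1 - w) q + w k and its
  shift by \<open>x\<close>, both in \<open>K\<close>. So the set on the right contains a translate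
  of w K.\<close>

lemma covariogram_ge:
  fixes K :: "'a::euclidean_space set"
  assumes K: "open K" "convex K" and w: "0 < w" "w < 1"
    and x: "(1 / (1 - w)) *\<^sub>R x \<in> difference_body K"
  shows "ennreal (w ^ DIM('a)) * emeasure lborel K \<le> emeasure lborel {y\<in>K. y + x \<in> K}"
proof -
  obtain q where q: "q \<in> K" "q + (1 / (1 - w)) *\<^sub>R x \<in> K"
    using x by (auto simp: difference_body_iff)
  have [measurable]: "K \<in> sets borel" using K by simp
  have "(1 - w) *\<^sub>R q + w *\<^sub>R k \<in> K" "(1 - w) *\<^sub>R q + w *\<^sub>R k + x \<in> K" if "k \<in> K" for k
  proof -
    show "(1 - w) *\<^sub>R q + w *\<^sub>R k \<in> K"
      by (rule convexD[OF K(2) q(1) that]) (use w in auto)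
    have "(1 - w) *\<^sub>R (q + (1 / (1 - w)) *\<^sub>R x) + w *\<^sub>R k \<in> K"
      by (rule convexD[OF K(2) q(2) that]) (use w in auto)
    also have "(1 - w) *\<^sub>R (q + (1 / (1 - w)) *\<^sub>R x) + w *\<^sub>R k = (1 - w) *\<^sub>R q + w *\<^sub>R k + x"
      using w by (simp add: scaleR_add_right)
    finally show "(1 - w) *\<^sub>R q + w *\<^sub>R k + x \<in> K" .
  qed
  then have "(\<lambda>k. (1 - w) *\<^sub>R q + w *\<^sub>R k) ` K \<subseteq> {y\<in>K. y + x \<in> K}"
    by auto
  then have "emeasure lborel ((\<lambda>k. (1 - w) *\<^sub>R q + w *\<^sub>R k) ` K) \<le> emeasure lborel {y\<in>K. y + x \<in> K}"
    by (rule emeasure_mono) measurable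
  moreover have "emeasure lborel ((\<lambda>k. (1 - w) *\<^sub>R q + w *\<^sub>R k) ` K) = ennreal (\<bar>w\<bar> ^ DIM('a)) * emeasure lborel K"
    by (rule emeasure_lborel_affine_image) (use w K in auto)
  ultimately show ?thesis
    using w by simp
qed

lemma emeasure_lborel_open_pos:
  fixes K :: "'a::euclidean_space set"
  assumes "open K" "K \<noteq> {}"
  shows "emeasure lborel K > 0"
proof (rule ccontr)
  assume "\<not> emeasure lborel K > 0"
  then have "K \<in> null_sets lborel"
    using assms(1) by (intro null_setsI) (auto simp: not_gr_zero)
  then show False
    using open_not_negligible[OF assms] by (auto simp: negligible_iff_null_sets null_sets_completionI)
qed

text \<open>Integrates the pointwise bound weight * V \<le> covariogram over all \<open>x\<close>
  and cancels one factor V.\<close>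

lemma rogers_shephard_open:
  fixes K :: "'a::euclidean_space set"
  assumes K: "open K" "convex K"
  shows "emeasure lborel (difference_body K) \<le> ennreal (real ((2 * DIM('a)) choose DIM('a))) * emeasure lborel K"
\<comment> \<open>The cancellation requires 0 < V < \<infinity>; the two remaining cases are
  trivial.\<close>
proof (cases "K = {} \<or> emeasure lborel K = \<infinity>")
  case True
  have "difference_body {} = ({} :: 'a set)"
    by (simp add: difference_body_def)
  moreover have "real ((2 * DIM('a)) choose DIM('a)) > 0"
    by simp
  ultimately show ?thesis
    using True by (metis emeasure_empty ennreal_mult_top ennreal_eq_0_iff infinity_ennreal_def mult_zero_right not_less order_refl top_greatest)
next
  case False
  let ?b = "real ((2 * DIM('a)) choose DIM('a))"
  let ?V = "emeasure lborel K"
  let ?J = "\<lambda>x::'a. dilation_weight (difference_body K) x"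
  have D: "open (difference_body K)" by (rule open_difference_body) fact
  have [measurable]: "K \<in> sets borel" "difference_body K \<in> sets borel" using K D by auto
  have V: "0 < ?V" "?V < \<infinity>"
    using False K by (auto simp: emeasure_lborel_open_pos top.not_eq_extremum)
  have "(\<integral>\<^sup>+x. ?J x * ?V \<partial>lborel) = (\<integral>\<^sup>+x. ?J x \<partial>lborel) * ?V"
    unfolding dilation_weight_def by (rule nn_integral_multc) measurable
  then have JV: "(\<integral>\<^sup>+x. ?J x * ?V \<partial>lborel) = ennreal (1 / ?b) * emeasure lborel (difference_body K) * ?V"
    by (simp only: nn_integral_dilation_weight[OF D])
  have "?J x * ?V \<le> emeasure lborel {y\<in>K. y + x \<in> K}" for x
  proof (rule dilation_weight_mult_le[OF V])
    have "emeasure lborel {y\<in>K. y + x \<in> K} \<le> ?V"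
      by (intro emeasure_mono) auto
    then show "emeasure lborel {y\<in>K. y + x \<in> K} < \<infinity>"
      using V(2) by (rule le_less_trans)
  qed (rule covariogram_ge[OF K])
  then have "(\<integral>\<^sup>+x. ?J x * ?V \<partial>lborel) \<le> (\<integral>\<^sup>+x. emeasure lborel {y\<in>K. y + x \<in> K} \<partial>lborel)"
    by (rule nn_integral_mono)
  then have "ennreal (1 / ?b) * emeasure lborel (difference_body K) * ?V \<le> ?V * ?V"
    by (simp only: nn_integral_covariogram[OF K(1)] JV)
  then have "?V * (ennreal (1 / ?b) * emeasure lborel (difference_body K)) \<le> ?V * ?V"
    by (subst mult.commute)
  then have "ennreal (1 / ?b) * emeasure lborel (difference_body K) \<le> ?V"
    by (subst (asm) ennreal_mult_le_mult_iff) (use V in auto)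
  then have "ennreal ?b * (ennreal (1 / ?b) * emeasure lborel (difference_body K)) \<le> ennreal ?b * ?V"
    by (rule mult_left_mono) simp
  moreover have "ennreal ?b * ennreal (1 / ?b) = 1"
    by (subst ennreal_mult[symmetric]) auto
  then have "ennreal ?b * (ennreal (1 / ?b) * emeasure lborel (difference_body K)) = emeasure lborel (difference_body K)"
    by (subst mult.assoc[symmetric]) simp
  ultimately show ?thesis
    by (simp only:)
qed

section \<open>From open to arbitrary convex sets\<close>

lemma convex_minus_interior_null:
  fixes K :: "'a::euclidean_space set"
  assumes "convex K" "interior K \<subseteq> A" "A \<subseteq> closure K"
  shows "A - interior K \<in> null_sets lebesgue"
proof -
  have "negligible (A - interior K)"
    using negligible_convex_frontier[OF assms(1)]
    by (rule negligible_subset) (use assms in \<open>auto simp: frontier_def\<close>)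
  then show ?thesis by (simp add: negligible_iff_null_sets)
qed

text \<open>Between interior and closure only a subset of the frontier of \<open>K\<close> can vary.
  It is negligible by convexity, and completeness of Lebesgue measure makes \<open>A\<close>
  measurable even if it is not Borel.\<close>

lemma
  fixes K :: "'a::euclidean_space set"
  assumes "convex K" "interior K \<subseteq> A" "A \<subseteq> closure K"
  shows lebesgue_sets_between_convex: "A \<in> sets lebesgue"
    and emeasure_between_convex: "emeasure lebesgue A = emeasure lborel (interior K)"
proof -
  have A: "A = interior K \<union> (A - interior K)" using assms by auto
  have null: "A - interior K \<in> null_sets lebesgue"
    by (rule convex_minus_interior_null) fact+
  have "interior K \<union> (A - interior K) \<in> sets lebesgue"
    by (rule sets.Un) (use null in auto)
  then show "A \<in> sets lebesgue"
    by (simp only: A[symmetric])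
  have "emeasure lebesgue A = emeasure lebesgue (interior K)"
    by (subst A, rule emeasure_Un_null_set) (use null in auto)
  then show "emeasure lebesgue A = emeasure lborel (interior K)"
    by simp
qed

lemma difference_body_subset_hyperplane:
  fixes K :: "'a::euclidean_space set"
  assumes "K \<subseteq> {x. a \<bullet> x = b}"
  shows "difference_body K \<subseteq> {x. a \<bullet> x = 0}"
proof -
  have "a \<bullet> x = b" if "x \<in> K" for x using assms that by blast
  then show ?thesis by (auto simp: difference_body_def inner_diff_right)
qed

text \<open>With nonempty interior, every point of \<open>K\<close> is a limit of interior points,
  and subtraction is continuous.\<close>

lemma difference_body_subset_closure:
  fixes K :: "'a::euclidean_space set"
  assumes K: "convex K" "interior K \<noteq> {}"
  shows "difference_body K \<subseteq> closure (difference_body (interior K))"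
proof
  fix x assume "x \<in> difference_body K"
  then obtain u v where x: "x = u - v" "u \<in> closure (interior K)" "v \<in> closure (interior K)"
    unfolding difference_body_def using convex_closure_interior[OF K] closure_subset[of K] by auto
  then obtain p q where p: "\<And>k. p k \<in> interior K" "p \<longlonglongrightarrow> u" and q: "\<And>k. q k \<in> interior K" "q \<longlonglongrightarrow> v"
    unfolding closure_sequential by blast
  have "(\<lambda>k. p k - q k) \<longlonglongrightarrow> x"
    unfolding x(1) by (intro tendsto_diff p q)
  moreover have "p k - q k \<in> difference_body (interior K)" for k
    using p(1) q(1) by (auto simp: difference_body_def)
  ultimately show "x \<in> closure (difference_body (interior K))"
    unfolding closure_sequential by (intro exI[of _ "\<lambda>k. p k - q k"]) auto
qed

text \<open>If the interior is empty, \<open>K\<close> lies in a hyperplane and its difference body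
  in the parallel one through the origin, so the left side vanishes. Otherwise both volumes are
  unchanged when \<open>K\<close> is replaced by its interior.\<close>

lemma rogers_shephard:
  fixes K :: "'a::euclidean_space set"
  assumes K: "convex K"
  shows "emeasure lebesgue (difference_body K)
    \<le> ennreal (real ((2 * DIM('a)) choose DIM('a))) * emeasure lebesgue K"
proof (cases "interior K = {}")
  case True
  then obtain a b where "a \<noteq> 0" "K \<subseteq> {x. a \<bullet> x = b}"
    using empty_interior_subset_hyperplane[OF K] by blast
  then have "negligible (difference_body K)"
    using negligible_hyperplane[of a 0] difference_body_subset_hyperplane[of K a b]
    by (blast intro: negligible_subset)
  then show ?thesis
    by (auto simp: negligible_iff_null_sets null_sets_def)
next
  case False
  have o: "open (difference_body (interior K))"
    by (simp add: open_difference_body)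
  have "difference_body (interior K) \<subseteq> difference_body K"
    unfolding difference_body_def using interior_subset[of K] by blast
  \<comment> \<open>The sandwich lemma is applied to the open convex set
    \<open>difference_body (interior K)\<close>, with \<open>difference_body K\<close> as the set
    between it and its closure.\<close>
  then have "emeasure lebesgue (difference_body K) = emeasure lborel (interior (difference_body (interior K)))"
    using difference_body_subset_closure[OF K False] o
    by (intro emeasure_between_convex convex_difference_body convex_interior K)
       (simp_all add: interior_open)
  also have "\<dots> = emeasure lborel (difference_body (interior K))"
    using o by (simp add: interior_open)
  also have "\<dots> \<le> ennreal (real ((2 * DIM('a)) choose DIM('a))) * emeasure lborel (interior K)"
    by (rule rogers_shephard_open) (auto intro: K convex_interior)
  also have "emeasure lborel (interior K) = emeasure lebesgue K"
    using emeasure_between_convex[OF K interior_subset closure_subset] by simp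
  finally show ?thesis .
qed

section \<open>The layer cake formula for Lebesgue measure\<close>

text \<open>Supplies the hypothesis of Fubini for the completed measure; a countable Borel cover by
  sets of finite measure serves for both measures.\<close>

lemma sigma_finite_lebesgue: "sigma_finite_measure (lebesgue :: 'a::euclidean_space measure)"
proof
  obtain A :: "'a set set" where A: "countable A" "A \<subseteq> sets lborel" "\<Union>A = space lborel"
    "\<forall>a\<in>A. emeasure lborel a \<noteq> \<infinity>"
    using lborel.sigma_finite_countable by blast
  then show "\<exists>A::'a set set. countable A \<and> A \<subseteq> sets lebesgue \<and> \<Union>A = space lebesgue
      \<and> (\<forall>a\<in>A. emeasure lebesgue a \<noteq> \<infinity>)"
    by (intro exI[of _ A]) auto
qed

text \<open>Writes a value \<open>c\<close> as the length of the interval (0, c), including c =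
  \<infinity>.\<close>

lemma nn_integral_ennreal_less:
  fixes c :: ennreal
  shows "(\<integral>\<^sup>+t. indicator {t. 0 < t \<and> ennreal t < c} t \<partial>lborel) = c"
proof -
  have [measurable]: "{t::real. 0 < t \<and> ennreal t < c} \<in> sets borel" by measurable
  have "(\<integral>\<^sup>+t. indicator {t. 0 < t \<and> ennreal t < c} t \<partial>lborel) = emeasure lborel {t. 0 < t \<and> ennreal t < c}"
    by (rule nn_integral_indicator) simp
  also have "\<dots> = c"
  proof (cases c)
    case (real r)
    then have "{t. 0 < t \<and> ennreal t < c} = {0<..<r}"
      by (auto simp: ennreal_less_iff)
    then show ?thesis using real by simp
  next
    case top
    \<comment> \<open>For infinite \<open>c\<close> the set contains (0, n) for every
      \<open>n\<close>.\<close>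
    have "ennreal (real n) \<le> emeasure lborel {t::real. 0 < t \<and> ennreal t < c}" for n
    proof -
      have "emeasure lborel {0<..<real n} \<le> emeasure lborel {t::real. 0 < t \<and> ennreal t < c}"
        by (rule emeasure_mono) (auto simp: top)
      then show ?thesis by simp
    qed
    then show ?thesis
      using top by (metis ennreal_of_nat_eq_real_of_nat ennreal_Ex_less_of_nat linorder_not_less top.not_eq_extremum)
  qed
  finally show ?thesis .
qed

lemma nn_integral_superlevel:
  fixes f :: "'a::euclidean_space \<Rightarrow> ennreal"
  assumes [measurable]: "f \<in> borel_measurable lebesgue"
  shows "(\<integral>\<^sup>+x. indicator {t. 0 < t \<and> ennreal t < f x} t \<partial>lebesgue)
    = indicator {0<..} t * emeasure lebesgue {x. ennreal t < f x}"
proof -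
  have "{x \<in> space lebesgue. ennreal t < f x} \<in> sets lebesgue" by measurable
  then have "(\<integral>\<^sup>+x. indicator {0<..} t * indicator {x. ennreal t < f x} x \<partial>lebesgue)
    = indicator {0<..} t * emeasure lebesgue {x. ennreal t < f x}"
    by (subst nn_integral_cmult_indicator) auto
  then show ?thesis
    by (simp add: indicator_def if_distrib[of "\<lambda>x. _ * x"] cong: if_cong)
       (auto intro!: nn_integral_cong)
qed

text \<open>As a function of the level this is a partial integral of a jointly measurable function.
  It allows a constant to be pulled out of the layer cake integral later.\<close>

lemma borel_measurable_superlevel_measure:
  fixes f :: "'a::euclidean_space \<Rightarrow> ennreal"
  assumes [measurable]: "f \<in> borel_measurable lebesgue"
  shows "(\<lambda>t. indicator {0<..} t * emeasure lebesgue {x. ennreal t < f x}) \<in> borel_measurable lborel"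
proof -
  interpret sigma_finite_measure "lebesgue :: 'a measure"
    by (rule sigma_finite_lebesgue)
  have "(\<lambda>t. \<integral>\<^sup>+x. indicator {t. 0 < t \<and> ennreal t < f x} t \<partial>lebesgue) \<in> borel_measurable lborel"
    by measurable
  then show ?thesis
    by (simp only: nn_integral_superlevel[OF assms])
qed

text \<open>Both sides measure the region 0 < t < f x under the graph, sliced by \<open>x\<close> on
  the left and by \<open>t\<close> on the right.\<close>

lemma layer_cake_lebesgue:
  fixes f :: "'a::euclidean_space \<Rightarrow> ennreal"
  assumes [measurable]: "f \<in> borel_measurable lebesgue"
  shows "(\<integral>\<^sup>+x. f x \<partial>lebesgue)
    = (\<integral>\<^sup>+t. indicator {0<..} t * emeasure lebesgue {x. ennreal t < f x} \<partial>lborel)"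
proof -
  interpret L: sigma_finite_measure "lebesgue :: 'a measure"
    by (rule sigma_finite_lebesgue)
  interpret P: pair_sigma_finite "lebesgue :: 'a measure" "lborel :: real measure"
    by standard
  have "(\<integral>\<^sup>+x. f x \<partial>lebesgue)
    = (\<integral>\<^sup>+x. \<integral>\<^sup>+t. indicator {t. 0 < t \<and> ennreal t < f x} t \<partial>lborel \<partial>lebesgue)"
    by (simp only: nn_integral_ennreal_less)
  also have "\<dots> = (\<integral>\<^sup>+t. \<integral>\<^sup>+x. indicator {t. 0 < t \<and> ennreal t < f x} t \<partial>lebesgue \<partial>lborel)"
    by (rule P.Fubini'[symmetric]) measurable
  finally show ?thesis
    by (simp only: nn_integral_superlevel[OF assms])
qed

section \<open>The equality case: the simplex\<close>

definition open_std_simplex :: "'a::euclidean_space set" where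
  "open_std_simplex = {x. (\<forall>i\<in>Basis. 0 < x \<bullet> i) \<and> (\<Sum>i\<in>Basis. x \<bullet> i) < 1}"

lemma open_std_simplex_eq_interior:
  "open_std_simplex = interior (convex hull (insert 0 Basis) :: 'a::euclidean_space set)"
  by (simp add: interior_std_simplex open_std_simplex_def)

lemma open_open_std_simplex: "open (open_std_simplex :: 'a::euclidean_space set)"
  by (simp add: open_std_simplex_eq_interior)

lemma convex_open_std_simplex: "convex (open_std_simplex :: 'a::euclidean_space set)"
  by (simp add: open_std_simplex_eq_interior convex_interior)

lemma bounded_open_std_simplex: "bounded (open_std_simplex :: 'a::euclidean_space set)"
proof -
  have "bounded (convex hull (insert 0 Basis) :: 'a set)"
    by (intro bounded_convex_hull finite_imp_bounded) simp
  then show ?thesis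
    unfolding open_std_simplex_eq_interior by (rule bounded_subset[OF _ interior_subset])
qed

lemma open_std_simplex_nonempty: "open_std_simplex \<noteq> ({} :: 'a::euclidean_space set)"
  by (rule interior_std_simplex_nonempty) (auto simp: open_std_simplex_eq_interior)

text \<open>The maximum of \<open>pos_sum x\<close> and \<open>pos_sum (- x)\<close> is the gauge of
  the difference body of the open standard simplex.\<close>

definition pos_sum :: "'a::euclidean_space \<Rightarrow> real" where
  "pos_sum x = (\<Sum>i\<in>Basis. max 0 (x \<bullet> i))"

lemma pos_sum_nonneg: "0 \<le> pos_sum x"
  unfolding pos_sum_def by (rule sum_nonneg) simp

lemma pos_sum_scaleR: "0 \<le> c \<Longrightarrow> pos_sum (c *\<^sub>R x) = c * pos_sum x"
  unfolding pos_sum_def sum_distrib_left by (rule sum.cong) (auto simp: max_mult_distrib_left)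

lemma pos_sum_diff: "pos_sum x - pos_sum (- x) = (\<Sum>i\<in>Basis. x \<bullet> i)"
  unfolding pos_sum_def sum_subtractf[symmetric] by (rule sum.cong) auto

lemma mem_difference_body_open_std_simplex:
  fixes u :: "'a::euclidean_space"
  assumes "pos_sum u < 1" "pos_sum (- u) < 1"
  shows "u \<in> difference_body open_std_simplex"
proof -
  \<comment> \<open>The witness \<open>y\<close> is the negative part of \<open>u\<close>, so that y
    + u is its positive part, both pushed into the open orthant by \<open>e\<close> in every
    coordinate. The total push n e is half of the available slack, which keeps both coordinate sums
    below 1.\<close>
  define e where "e = (1 - max (pos_sum u) (pos_sum (- u))) / (2 * DIM('a))"
  define y where "y = (\<Sum>i\<in>Basis. (max 0 (- (u \<bullet> i)) + e) *\<^sub>R i)"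
  have e: "e > 0" "DIM('a) * e = (1 - max (pos_sum u) (pos_sum (- u))) / 2"
    using assms by (auto simp: e_def)
  have y: "y \<bullet> i = max 0 (- (u \<bullet> i)) + e" if "i \<in> Basis" for i
    using that by (simp add: y_def)
  have "(\<Sum>i\<in>Basis. y \<bullet> i) = (\<Sum>i\<in>Basis. max 0 ((- u) \<bullet> i) + e)"
    by (rule sum.cong) (auto simp: y)
  then have sy: "(\<Sum>i\<in>Basis. y \<bullet> i) = pos_sum (- u) + DIM('a) * e"
    by (simp add: pos_sum_def sum.distrib)
  have sy': "(\<Sum>i\<in>Basis. (y + u) \<bullet> i) = pos_sum u + DIM('a) * e"
    using sy pos_sum_diff[of u] by (simp add: inner_add_left sum.distrib)
  have "y \<in> open_std_simplex"
    using e sy assms by (auto simp: open_std_simplex_def y add_nonneg_pos)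
  moreover have "0 < (y + u) \<bullet> i" if "i \<in> Basis" for i
    using e(1) y[OF that] by (simp add: inner_add_left)
  then have "y + u \<in> open_std_simplex"
    using e(2) sy' assms by (auto simp: open_std_simplex_def)
  ultimately show ?thesis by (auto simp: difference_body_iff)
qed

text \<open>The vector \<open>m\<close> is the negative part of \<open>x\<close>: positivity of
  \<open>y\<close> and y + x says exactly that \<open>y\<close> exceeds \<open>m\<close> in each
  coordinate. Hence the simplex and its shift meet inside a translate of (1 - r) times the
  simplex.\<close>

lemma open_std_simplex_Int_translate:
  fixes x y :: "'a::euclidean_space"
  defines "r \<equiv> max (pos_sum x) (pos_sum (- x))"
    and "m \<equiv> \<Sum>i\<in>Basis. max 0 (- (x \<bullet> i)) *\<^sub>R i"
  assumes y: "y \<in> open_std_simplex" "y + x \<in> open_std_simplex"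
  shows "r < 1" "y \<in> (\<lambda>z. m + (1 - r) *\<^sub>R z) ` open_std_simplex"
proof -
  have m: "m \<bullet> i = max 0 (- (x \<bullet> i))" if "i \<in> Basis" for i
    using that by (simp add: m_def)
  have ym: "0 < (y - m) \<bullet> i" if "i \<in> Basis" for i
    using y that by (auto simp: open_std_simplex_def inner_diff_left inner_add_left m)
  have sm: "(\<Sum>i\<in>Basis. m \<bullet> i) = pos_sum (- x)"
    unfolding pos_sum_def by (rule sum.cong) (auto simp: m)
  have "(\<Sum>i\<in>Basis. y \<bullet> i) < 1" "(\<Sum>i\<in>Basis. y \<bullet> i) + (\<Sum>i\<in>Basis. x \<bullet> i) < 1"
    using y by (auto simp: open_std_simplex_def inner_add_left sum.distrib)
  \<comment> \<open>The coordinate sum of \<open>y\<close> gives the bound 1 -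
    \<open>pos_sum (- x)\<close>, that of y + x gives 1 - \<open>pos_sum x\<close>; \<open>r\<close>
    takes the stronger of the two.\<close>
  then have s: "(\<Sum>i\<in>Basis. (y - m) \<bullet> i) < 1 - r"
    using pos_sum_diff[of x] by (auto simp: r_def inner_diff_left sum_subtractf sm)
  moreover have "0 \<le> (\<Sum>i\<in>Basis. (y - m) \<bullet> i)"
    by (rule sum_nonneg) (use ym in \<open>auto intro: less_imp_le\<close>)
  ultimately show r: "r < 1" by linarith
  define z where "z = (1 / (1 - r)) *\<^sub>R (y - m)"
  have "(\<Sum>i\<in>Basis. z \<bullet> i) = (\<Sum>i\<in>Basis. (y - m) \<bullet> i) / (1 - r)"
    unfolding z_def by (simp add: sum_divide_distrib)
  also have "\<dots> < 1" using s r by simp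
  finally have "z \<in> open_std_simplex"
    using ym r by (auto simp: open_std_simplex_def z_def)
  moreover have "y = m + (1 - r) *\<^sub>R z"
    using r by (simp add: z_def)
  ultimately show "y \<in> (\<lambda>z. m + (1 - r) *\<^sub>R z) ` open_std_simplex"
    by blast
qed

text \<open>Reverses the general pointwise bound. The intersection has volume at most (1 - r)^n V,
  and for w < 1 - r the point x/(1 - w) has gauge r/(1 - w) < 1, so the weight is at least (1 -
  r)^n.\<close>

lemma covariogram_open_std_simplex_le:
  fixes x :: "'a::euclidean_space"
  defines "S \<equiv> open_std_simplex :: 'a set"
  shows "emeasure lborel {y\<in>S. y + x \<in> S} \<le>
    dilation_weight (difference_body S) x * emeasure lborel S"
proof (cases "{y\<in>S. y + x \<in> S} = {}")
  case True
  then show ?thesis by (simp only: emeasure_empty zero_le)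
next
  case False
  define r where "r = max (pos_sum x) (pos_sum (- x))"
  define m where "m = (\<Sum>i\<in>Basis. max 0 (- (x \<bullet> i)) *\<^sub>R i)"
  have o: "open S" by (simp add: S_def open_open_std_simplex)
  have r: "0 \<le> r" "r < 1"
    using False open_std_simplex_Int_translate(1)[of _ x] pos_sum_nonneg[of x]
    by (auto simp: r_def S_def)
  have eq: "(\<lambda>z. m + (1 - r) *\<^sub>R z) ` S = (+) m ` ((*\<^sub>R) (1 - r) ` S)"
    by (simp add: image_image)
  have "open ((\<lambda>z. m + (1 - r) *\<^sub>R z) ` S)"
    unfolding eq using o r by (intro open_translation open_scaling) auto
  then have "emeasure lborel {y\<in>S. y + x \<in> S} \<le> emeasure lborel ((\<lambda>z. m + (1 - r) *\<^sub>R z) ` S)"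
    using open_std_simplex_Int_translate(2)[of _ x]
    by (intro emeasure_mono) (auto simp: S_def r_def m_def)
  also have "\<dots> = ennreal ((1 - r) ^ DIM('a)) * emeasure lborel S"
    using r o by (subst emeasure_lborel_affine_image) auto
  also have "\<dots> \<le> dilation_weight (difference_body S) x * emeasure lborel S"
  proof (rule mult_right_mono[OF dilation_weight_ge])
    fix w :: real assume w: "0 < w" "w < 1 - r"
    then have "w < 1" using r by simp
    have "pos_sum ((1 / (1 - w)) *\<^sub>R x) = pos_sum x / (1 - w)"
      using \<open>w < 1\<close> by (simp add: pos_sum_scaleR)
    moreover have "pos_sum (- ((1 / (1 - w)) *\<^sub>R x)) = pos_sum (- x) / (1 - w)"
      using \<open>w < 1\<close> pos_sum_scaleR[of "1 / (1 - w)" "- x"] by simp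
    ultimately show "(1 / (1 - w)) *\<^sub>R x \<in> difference_body S"
      unfolding S_def using w \<open>w < 1\<close>
      by (intro mem_difference_body_open_std_simplex) (simp_all add: r_def)
  qed (use r in auto)
  finally show ?thesis .
qed

lemma emeasure_open_std_simplex_pos: "0 < emeasure lborel (open_std_simplex :: 'a::euclidean_space set)"
  by (intro emeasure_lborel_open_pos open_open_std_simplex open_std_simplex_nonempty)

lemma emeasure_open_std_simplex_finite: "emeasure lborel (open_std_simplex :: 'a::euclidean_space set) < \<infinity>"
  by (intro emeasure_bounded_finite bounded_open_std_simplex)

text \<open>The integration argument for open convex sets, run with the reversed pointwise
  bound.\<close>

lemma rogers_shephard_open_std_simplex:
  "ennreal (real ((2 * DIM('a)) choose DIM('a))) * emeasure lborel (open_std_simplex :: 'a::euclidean_space set)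
     \<le> emeasure lborel (difference_body (open_std_simplex :: 'a set))"
proof -
  let ?S = "open_std_simplex :: 'a set"
  let ?b = "real ((2 * DIM('a)) choose DIM('a))"
  let ?V = "emeasure lborel ?S"
  let ?J = "\<lambda>x::'a. dilation_weight (difference_body ?S) x"
  have D: "open (difference_body ?S)" by (intro open_difference_body open_open_std_simplex)
  have [measurable]: "difference_body ?S \<in> sets borel" using D by auto
  have "?V * ?V = (\<integral>\<^sup>+x. emeasure lborel {y\<in>?S. y + x \<in> ?S} \<partial>lborel)"
    by (rule nn_integral_covariogram[OF open_open_std_simplex, symmetric])
  also have "\<dots> \<le> (\<integral>\<^sup>+x. ?J x * ?V \<partial>lborel)"
    by (intro nn_integral_mono covariogram_open_std_simplex_le)
  also have "\<dots> = (\<integral>\<^sup>+x. ?J x \<partial>lborel) * ?V"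
    unfolding dilation_weight_def by (rule nn_integral_multc) measurable
  also have "\<dots> = ?V * (ennreal (1 / ?b) * emeasure lborel (difference_body ?S))"
    by (subst nn_integral_dilation_weight[OF D]) (rule mult.commute)
  finally have "?V \<le> ennreal (1 / ?b) * emeasure lborel (difference_body ?S)"
    by (subst (asm) ennreal_mult_le_mult_iff)
      (use emeasure_open_std_simplex_pos[where 'a='a] emeasure_open_std_simplex_finite[where 'a='a] in auto)
  then have "ennreal ?b * ?V \<le> ennreal ?b * (ennreal (1 / ?b) * emeasure lborel (difference_body ?S))"
    by (rule mult_left_mono) simp
  moreover have "ennreal ?b * ennreal (1 / ?b) = 1"
    by (subst ennreal_mult[symmetric]) auto
  then have "ennreal ?b * (ennreal (1 / ?b) * emeasure lborel (difference_body ?S)) = emeasure lborel (difference_body ?S)"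
    by (subst mult.assoc[symmetric]) simp
  ultimately show ?thesis
    by (simp only:)
qed

section \<open>Superlevel sets and the two bounds on the constant\<close>

lemma convex_superlevel_quasi_concave:
  assumes "quasi_concave f"
  shows "convex {x. c < f x}"
proof (rule convexI)
  fix x y and u v :: real
  assume xy: "x \<in> {x. c < f x}" "y \<in> {x. c < f x}" and uv: "0 \<le> u" "0 \<le> v" "u + v = 1"
  then have "v = 1 - u" "u \<in> {0..1}" by auto
  then have "min (f x) (f y) \<le> f (u *\<^sub>R x + v *\<^sub>R y)"
    using assms unfolding quasi_concave_def by simp
  moreover have "c < min (f x) (f y)" using xy by simp
  ultimately have "c < f (u *\<^sub>R x + v *\<^sub>R y)" by (rule less_le_trans[rotated])
  then show "u *\<^sub>R x + v *\<^sub>R y \<in> {x. c < f x}" by simp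
qed

text \<open>Strict levels make this exact: a supremum exceeds \<open>c\<close> iff some member does,
  whether or not it is attained. The sign in f (- y) turns the sum into a difference.\<close>

lemma superlevel_diff_fun:
  "{z. c < diff_fun f z} = (*\<^sub>R) (1 / 2) ` difference_body {x. c < f x}"
proof (intro set_eqI iffI)
  fix z assume "z \<in> {z. c < diff_fun f z}"
  then obtain x y where "c < min (f x) (f (- y))" "(1 / 2) *\<^sub>R (x + y) = z"
    by (auto simp: diff_fun_def less_Sup_iff)
  moreover from this have "x - (- y) \<in> difference_body {x. c < f x}"
    unfolding difference_body_def by (intro CollectI exI[of _ x] exI[of _ "- y"]) simp
  ultimately show "z \<in> (*\<^sub>R) (1 / 2) ` difference_body {x. c < f x}"
    by (intro image_eqI[of _ _ "x + y"]) simp_all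
next
  fix z assume "z \<in> (*\<^sub>R) (1 / 2) ` difference_body {x. c < f x}"
  then obtain x y where *: "z = (1 / 2) *\<^sub>R (x - y)" "c < f x" "c < f y"
    by (auto simp: difference_body_def)
  then have "min (f x) (f (- (- y))) \<in> {min (f x) (f (- y)) | x y. (1 / 2) *\<^sub>R (x + y) = z}"
    by (intro CollectI exI[of _ x] exI[of _ "- y"]) simp
  then have "min (f x) (f (- (- y))) \<le> diff_fun f z"
    unfolding diff_fun_def by (rule Sup_upper)
  moreover have "c < min (f x) (f (- (- y)))" using * by simp
  ultimately have "c < diff_fun f z" by (rule less_le_trans[rotated])
  then show "z \<in> {z. c < diff_fun f z}" by simp
qed

lemma borel_measurable_lebesgue_convex_superlevel:
  fixes f :: "'a::euclidean_space \<Rightarrow> ennreal"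
  assumes "\<And>c. convex {x. c < f x}"
  shows "f \<in> borel_measurable lebesgue"
  by (rule borel_measurableI_greater)
    (use lebesgue_sets_between_convex[OF assms interior_subset closure_subset] in simp)

text \<open>Compares the superlevel sets level by level and integrates over the levels. Halving
  contributes 2^(-n), Rogers--Shephard the binomial coefficient.\<close>

lemma nn_integral_diff_fun_le:
  fixes f :: "real ^ 'n::finite \<Rightarrow> ennreal"
  assumes f: "quasi_concave f"
  shows "(\<integral>\<^sup>+z. diff_fun f z \<partial>lebesgue)
    \<le> ennreal (1 / 2 ^ CARD('n) * real ((2 * CARD('n)) choose CARD('n))) * (\<integral>\<^sup>+x. f x \<partial>lebesgue)"
    (is "_ \<le> ?C * _")
proof -
  have cf: "convex {x. c < f x}" for c
    by (rule convex_superlevel_quasi_concave[OF f])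
  have mf: "f \<in> borel_measurable lebesgue"
    by (rule borel_measurable_lebesgue_convex_superlevel[OF cf])
  have cd: "convex {x. c < diff_fun f x}" for c
    unfolding superlevel_diff_fun by (intro convex_scaling convex_difference_body cf)
  have md: "diff_fun f \<in> borel_measurable lebesgue"
    by (rule borel_measurable_lebesgue_convex_superlevel[OF cd])
  have le: "emeasure lebesgue {z. c < diff_fun f z} \<le> ?C * emeasure lebesgue {x. c < f x}" for c
  proof -
    have "emeasure lebesgue {z. c < diff_fun f z}
      = ennreal (1 / 2 ^ CARD('n)) * emeasure lebesgue (difference_body {x. c < f x})"
      unfolding superlevel_diff_fun
      using emeasure_lebesgue_affine[of "1 / 2" 0 "difference_body {x. c < f x}"]
      by (simp add: power_one_over)
    also have "\<dots> \<le> ennreal (1 / 2 ^ CARD('n)) *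
        (ennreal (real ((2 * CARD('n)) choose CARD('n))) * emeasure lebesgue {x. c < f x})"
      using rogers_shephard[OF cf, of c] by (intro mult_left_mono) simp_all
    also have "\<dots> = ?C * emeasure lebesgue {x. c < f x}"
      by (subst mult.assoc[symmetric], subst ennreal_mult[symmetric]) simp_all
    finally show ?thesis .
  qed
  have "(\<integral>\<^sup>+z. diff_fun f z \<partial>lebesgue)
      = (\<integral>\<^sup>+t. indicator {0<..} t * emeasure lebesgue {z. ennreal t < diff_fun f z} \<partial>lborel)"
    by (rule layer_cake_lebesgue[OF md])
  also have "\<dots> \<le> (\<integral>\<^sup>+t. ?C * (indicator {0<..} t * emeasure lebesgue {x. ennreal t < f x}) \<partial>lborel)"
    by (rule nn_integral_mono) (use le in \<open>auto simp: indicator_def\<close>)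
  also have "\<dots> = ?C * (\<integral>\<^sup>+t. indicator {0<..} t * emeasure lebesgue {x. ennreal t < f x} \<partial>lborel)"
    by (intro nn_integral_cmult borel_measurable_superlevel_measure mf)
  also have "\<dots> = ?C * (\<integral>\<^sup>+x. f x \<partial>lebesgue)"
    by (simp only: layer_cake_lebesgue[OF mf])
  finally show ?thesis .
qed

lemma quasi_concave_indicator:
  assumes "convex K"
  shows "quasi_concave (indicator K)"
  unfolding quasi_concave_def
proof (intro allI ballI)
  fix x y and t :: real assume "t \<in> {0..1}"
  then have "t *\<^sub>R x + (1 - t) *\<^sub>R y \<in> K" if "x \<in> K" "y \<in> K"
    using convexD[OF assms that, of t "1 - t"] by simp
  then show "min (indicator K x) (indicator K y) \<le> (indicator K (t *\<^sub>R x + (1 - t) *\<^sub>R y) :: ennreal)"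
    by (auto simp: indicator_def)
qed

text \<open>The difference function of the indicator is at least 1 on (S - S)/2, whose volume is
  bounded below by the simplex case.\<close>

lemma nn_integral_diff_fun_simplex_ge:
  defines "S \<equiv> open_std_simplex :: (real ^ 'n::finite) set"
  shows "ennreal (1 / 2 ^ CARD('n) * real ((2 * CARD('n)) choose CARD('n))) * emeasure lborel S
    \<le> (\<integral>\<^sup>+z. diff_fun (indicator S) z \<partial>lebesgue)"
proof -
  let ?D = "difference_body S"
  let ?H = "(*\<^sub>R) (1 / 2) ` ?D"
  have "open ?D"
    unfolding S_def by (intro open_difference_body open_open_std_simplex)
  then have H: "?H \<in> sets lebesgue"
    using open_scaling[of "1 / 2" ?D] by simp
  have "ennreal (1 / 2 ^ CARD('n) * real ((2 * CARD('n)) choose CARD('n))) * emeasure lborel S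
    = ennreal (1 / 2 ^ CARD('n)) * (ennreal (real ((2 * CARD('n)) choose CARD('n))) * emeasure lborel S)"
    by (subst mult.assoc[symmetric], subst ennreal_mult[symmetric]) simp_all
  also have "\<dots> \<le> ennreal (1 / 2 ^ CARD('n)) * emeasure lborel ?D"
    using rogers_shephard_open_std_simplex[where 'a="real ^ 'n"]
    unfolding S_def by (intro mult_left_mono) simp_all
  also have "\<dots> = emeasure lebesgue ?H"
    using emeasure_lebesgue_affine[of "1 / 2" 0 ?D] \<open>open ?D\<close>
    by (simp add: power_one_over)
  also have "\<dots> = (\<integral>\<^sup>+z. indicator ?H z \<partial>lebesgue)"
    using H by simp
  also have "\<dots> \<le> (\<integral>\<^sup>+z. diff_fun (indicator S) z \<partial>lebesgue)"
  proof (rule nn_integral_mono)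
    fix z
    show "indicator ?H z \<le> diff_fun (indicator S) z"
    proof (cases "z \<in> ?H")
      case True
      then obtain x y where "z = (1 / 2) *\<^sub>R (x - y)" "x \<in> S" "y \<in> S"
        by (auto simp: difference_body_def)
      then have "(1::ennreal) \<in> {min (indicator S x) (indicator S (- y)) | x y. (1 / 2) *\<^sub>R (x + y) = z}"
        by (intro CollectI exI[of _ x] exI[of _ "- y"]) simp
      then show ?thesis
        unfolding diff_fun_def using True by (simp add: Sup_upper)
    qed simp
  qed
  finally show ?thesis .
qed

theorem corollary4p4:
  shows "diff_const TYPE('n::finite) =
    ennreal (1 / 2 ^ CARD('n) * real ((2 * CARD('n)) choose CARD('n)))"
    (is "_ = ?C")
proof (rule antisym)
  show "diff_const TYPE('n) \<le> ?C"
    unfolding diff_const_def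
  proof (rule Sup_least, clarify)
    fix f :: "real ^ 'n \<Rightarrow> ennreal"
    assume f: "quasi_concave f" and "0 < (\<integral>\<^sup>+x. f x \<partial>lebesgue)" "(\<integral>\<^sup>+x. f x \<partial>lebesgue) < \<infinity>"
    then show "(\<integral>\<^sup>+z. diff_fun f z \<partial>lebesgue) / (\<integral>\<^sup>+x. f x \<partial>lebesgue) \<le> ?C"
      using divide_right_mono_ennreal[OF nn_integral_diff_fun_le[OF f], of "\<integral>\<^sup>+x. f x \<partial>lebesgue"]
      by (subst (asm) ennreal_mult_divide_eq) auto
  qed
next
  \<comment> \<open>The indicator of the simplex is an admissible competitor: it is quasi-concave,
    and its integral, the volume of the simplex, is positive and finite.\<close>
  let ?S = "open_std_simplex :: (real ^ 'n) set"
  let ?I = "\<lambda>f :: real ^ 'n \<Rightarrow> ennreal. \<integral>\<^sup>+x. f x \<partial>lebesgue"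
  have I: "?I (indicator ?S) = emeasure lborel ?S"
    using open_open_std_simplex[where 'a="real ^ 'n"] by simp
  note V = emeasure_open_std_simplex_pos[where 'a="real ^ 'n"] emeasure_open_std_simplex_finite[where 'a="real ^ 'n"]
  have "?C = ?C * ?I (indicator ?S) / ?I (indicator ?S)"
    unfolding I using V by (subst ennreal_mult_divide_eq) auto
  also have "\<dots> \<le> ?I (diff_fun (indicator ?S)) / ?I (indicator ?S)"
    unfolding I by (rule divide_right_mono_ennreal[OF nn_integral_diff_fun_simplex_ge])
  also have "\<dots> \<le> diff_const TYPE('n)"
    unfolding diff_const_def
    by (rule Sup_upper, rule CollectI, rule exI[of _ "indicator ?S"])
      (use V I quasi_concave_indicator[OF convex_open_std_simplex] in simp)
  finally show "?C \<le> diff_const TYPE('n)" .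
qed

end
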